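(* There is an absolute constant $C>0$ such that the following holds. Let $K$ be a compact subset of $\mathbb{R}^2$ with nonempty interior, and put $C_K = C\,\operatorname{diam}(K)^2$. Then for all $f \in C^2(\mathbb{R}^2)$ with $\operatorname{supp} f \subseteq K$, $$\bigl(\operatorname{osc}_K f\bigr)^2 \le C_K \int_K |\det D^2 f(x)|\,\mathrm{d}x .$$
   Context: For a nonempty compact set $A\subseteq\mathbb{R}^2$ and a continuous function $f$, $\operatorname{osc}_A f := \sup_A f - \inf_A f$. $D^2 f$ is the Hessian matrix of $f$, and $\operatorname{diam}(K)$ is the Euclidean diameter of $K$. *)

theory Defs
  imports "HOL-Analysis.Analysis"
begin

(* Meaningful for f bounded on a nonempty A; Sup and Inf are unspecified otherwise. *)
definition osc_on :: "'a set \<Rightarrow> ('a \<Rightarrow> real) \<Rightarrow> real" where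
  "osc_on A f = (SUP x\<in>A. f x) - (INF x\<in>A. f x)"

definition supp :: "('a::topological_space \<Rightarrow> real) \<Rightarrow> 'a set" where
  "supp f = closure {x. f x \<noteq> 0}"

definition grad :: "(real ^ 'n \<Rightarrow> real) \<Rightarrow> real ^ 'n \<Rightarrow> real ^ 'n" where
  "grad f x = (\<chi> i. frechet_derivative f (at x) (axis i 1))"

(* The (i, j) entry is the j-th partial derivative of the i-th partial derivative of f. *)
definition hessian :: "(real ^ 'n \<Rightarrow> real) \<Rightarrow> real ^ 'n \<Rightarrow> real ^ 'n ^ 'n" where
  "hessian f x = jacobian (grad f) (at x)"

(* Continuity of f and of its gradient follows from the differentiability clauses. *)
definition C2 :: "(real ^ 'n \<Rightarrow> real) \<Rightarrow> bool" where
  "C2 f \<longleftrightarrow>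
     (\<forall>x. f differentiable (at x)) \<and>
     (\<forall>x. grad f differentiable (at x)) \<and>
     continuous_on UNIV (hessian f)"

end

theory Submission
  imports Defs
begin

text \<open>
  The inequality is the Aleksandrov--Bakelman--Pucci argument in its simplest form.  Suppose
  \<open>f a > 0\<close>, let \<open>d\<close> be the diameter of \<open>K\<close>, and take any vector \<open>p\<close> with \<open>norm p < f a / d\<close>.
  A plane of slope \<open>p\<close> falls or rises by less than \<open>f a\<close> across \<open>K\<close>, so when it is lowered
  onto the graph of \<open>f\<close> over \<open>K\<close> it first touches at a point where \<open>f\<close> is positive.  Such a point is
  interior to \<open>K\<close>, and there the gradient of \<open>f\<close> is \<open>p\<close>.  So the gradient map
  sends \<open>K\<close> onto a set that contains the ball of radius \<open>f a / d\<close> about the origin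
  (\<open>ball_subset_grad_image\<close>; negative values of \<open>f\<close> reduce to positive ones, because the ball
  is symmetric).

  The Hessian is the Jacobian matrix of the gradient map, so the area of the image is at most the
  integral of \<open>\<bar>det (hessian f)\<bar>\<close> over \<open>K\<close>.  Comparing it with the area of the ball gives
  \<open>pi * (f a / d)\<^sup>2 \<le> I\<close>, where \<open>I\<close> is that integral (\<open>ABP_estimate\<close>, in any dimension).  This
  holds at every point \<open>a\<close>, and the oscillation is at most twice a bound for \<open>\<bar>f\<bar>\<close>; hence the
  constant \<open>4 / pi\<close>.
\<close>

text \<open>
  Each slope \<open>p\<close> in the ball is the gradient at a maximum point over \<open>K\<close> of \<open>f\<close> minus the linear
  function of slope \<open>p\<close> through \<open>a\<close>.  The bound on \<open>p\<close> keeps that maximum away from the zero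
  set of \<open>f\<close>, and thereby from the boundary of \<open>K\<close>.
\<close>
lemma ball_subset_grad_image_pos:
  fixes f :: "real ^ 'n \<Rightarrow> real"
  assumes K: "compact K"
    and diff: "\<And>x. f differentiable (at x)"
    and zero: "\<And>x. x \<notin> K \<Longrightarrow> f x = 0"
    and a: "f a > 0"
  shows "ball 0 (f a / diameter K) \<subseteq> grad f ` K"
proof
  fix p :: "real ^ 'n" assume p: "p \<in> ball 0 (f a / diameter K)"
  have aK: "a \<in> K" using zero[of a] a by force
  (* Division by zero would give the empty ball. *)
  have dpos: "diameter K > 0"
    using p diameter_ge_0[OF compact_imp_bounded[OF K]] by (cases "diameter K = 0") auto
  have pd: "norm p * diameter K < f a" using p dpos by (simp add: field_simps)
  define g where "g y = f y - p \<bullet> (y - a)" for y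
  have cf: "continuous_on UNIV f"
    using diff by (meson continuous_at_imp_continuous_on differentiable_imp_continuous_within)
  have cg: "continuous_on K g"
    unfolding g_def by (intro continuous_intros continuous_on_subset[OF cf]) auto
  obtain x where x: "x \<in> K" "\<And>y. y \<in> K \<Longrightarrow> g y \<le> g x"
    using continuous_attains_sup[OF K _ cg] aK by blast
  have slope: "- (p \<bullet> (y - a)) < f a" if "y \<in> K" for y
  proof -
    have "- (p \<bullet> (y - a)) \<le> norm p * norm (y - a)"
      using Cauchy_Schwarz_ineq2[of p "y - a"] by linarith
    also have "norm (y - a) \<le> diameter K"
      using diameter_bounded_bound[OF compact_imp_bounded[OF K] that aK] by (simp add: dist_norm)
    then have "norm p * norm (y - a) \<le> norm p * diameter K"
      by (intro mult_left_mono) auto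
    finally show ?thesis using pd by linarith
  qed
  have "g a = f a" by (simp add: g_def)
  then have fx: "f x > 0" using x(2)[OF aK] slope[OF x(1)] by (simp add: g_def)
  (* On this open subset of K, the maximum over K becomes a local maximum of g. *)
  have op: "open {y. f y > 0}"
    using open_Collect_less[OF continuous_on_const cf] by simp
  have sub: "{y. f y > 0} \<subseteq> K" using zero by force
  have fd: "(f has_derivative frechet_derivative f (at x)) (at x)"
    using diff frechet_derivative_works by blast
  have "(g has_derivative (\<lambda>v. frechet_derivative f (at x) v - p \<bullet> v)) (at x)"
    unfolding g_def by (auto intro!: derivative_eq_intros fd)
  then have "(\<lambda>v. frechet_derivative f (at x) v - p \<bullet> v) = (\<lambda>v. 0)"
    using fx op sub x(2) by (intro differential_zero_maxmin[of x "{y. f y > 0}" g]) auto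
  then have "frechet_derivative f (at x) v = p \<bullet> v" for v by (metis eq_iff_diff_eq_0)
  then have "grad f x = p" by (simp add: grad_def vec_eq_iff inner_axis)
  then show "p \<in> grad f ` K" using x(1) by blast
qed

lemma grad_uminus:
  assumes "f differentiable (at x)"
  shows "grad (\<lambda>y. - f y) x = - grad f x"
  using frechet_derivative_at[OF has_derivative_minus[OF assms[unfolded frechet_derivative_works]]]
  by (simp add: grad_def vec_eq_iff fun_eq_iff flip: frechet_derivative_works)

lemma ball_subset_grad_image:
  fixes f :: "real ^ 'n \<Rightarrow> real"
  assumes K: "compact K"
    and diff: "\<And>x. f differentiable (at x)"
    and zero: "\<And>x. x \<notin> K \<Longrightarrow> f x = 0"
  shows "ball 0 (\<bar>f a\<bar> / diameter K) \<subseteq> grad f ` K"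
proof (cases "f a" "0 :: real" rule: linorder_cases)
  case less
  have neg: "ball 0 (- f a / diameter K) \<subseteq> grad (\<lambda>y. - f y) ` K"
    using less zero diff by (intro ball_subset_grad_image_pos[OF K]) auto
  show ?thesis
  proof
    fix p :: "real ^ 'n" assume "p \<in> ball 0 (\<bar>f a\<bar> / diameter K)"
    then have "- p \<in> ball 0 (- f a / diameter K)" using less by simp
    then have "- p \<in> grad (\<lambda>y. - f y) ` K" using neg by blast
    then show "p \<in> grad f ` K" using grad_uminus[OF diff] by auto
  qed
next
  case greater
  then show ?thesis using ball_subset_grad_image_pos[OF K diff zero] by simp
qed simp

text \<open>
  The gradient map is in general far from injective on \<open>K\<close>.  A gradient value with several
  preimages is counted once in the volume of \<open>grad f ` K\<close> and several times in the integral of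
  \<open>\<bar>det (hessian f)\<bar>\<close>, so the volume is bounded by the integral.
\<close>
theorem ABP_estimate:
  fixes f :: "real ^ 'n::{finite,wellorder} \<Rightarrow> real"
  assumes K: "compact K" and C2: "C2 f"
    and zero: "\<And>x. x \<notin> K \<Longrightarrow> f x = 0"
  shows "unit_ball_vol (real CARD('n)) * (\<bar>f a\<bar> / diameter K) ^ CARD('n)
    \<le> (LINT x:K|lborel. \<bar>det (hessian f x)\<bar>)"
proof -
  define r where "r = \<bar>f a\<bar> / diameter K"
  have r: "r \<ge> 0"
    using diameter_ge_0[OF compact_imp_bounded[OF K]] by (simp add: r_def)
  have diff: "\<And>x. f differentiable (at x)" and diff2: "\<And>x. grad f differentiable (at x)"
    and cont: "continuous_on UNIV (hessian f)"
    using C2 by (auto simp: C2_def)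
  have hess: "hessian f x = matrix (frechet_derivative (grad f) (at x))" for x
    by (simp add: hessian_def jacobian_def)
  have "continuous_on K (\<lambda>x. \<bar>det (hessian f x)\<bar>)"
    unfolding det_def by (intro continuous_intros continuous_on_subset[OF cont]) auto
  then have int: "set_integrable lborel K (\<lambda>x. \<bar>det (hessian f x)\<bar>)"
    unfolding set_integrable_def by (rule borel_integrable_compact[OF K])
  note int_eq = set_borel_integral_eq_integral[OF int]
  have der: "(grad f has_derivative frechet_derivative (grad f) (at x)) (at x within K)" for x
    using diff2[of x] by (meson frechet_derivative_works has_derivative_at_withinI)
  have K_meas: "K \<in> sets lebesgue" using K by (simp add: lmeasurable_compact fmeasurableD)
  have image: "grad f ` K \<in> lmeasurable"
    using measurable_differentiable_image[OF K_meas der] int_eq(1) by (simp add: hess)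
  have "measure lebesgue (ball (0 :: (real, 'n) vec) r) \<le> measure lebesgue (grad f ` K)"
    unfolding r_def
    by (intro measure_mono_fmeasurable[OF _ _ image] ball_subset_grad_image[OF K diff zero]) auto
  also have "\<dots> \<le> integral K (\<lambda>x. \<bar>det (hessian f x)\<bar>)"
    using measure_differentiable_image[OF K_meas der] int_eq(1) by (simp add: hess)
  finally have "measure lebesgue (ball (0 :: (real, 'n) vec) r)
      \<le> (LINT x:K|lborel. \<bar>det (hessian f x)\<bar>)"
    using int_eq(2) by simp
  then show ?thesis
    using content_ball[OF r, of "0 :: (real, 'n) vec"] by (simp add: measure_completion flip: r_def)
qed

lemma osc_on_le:
  assumes "K \<noteq> {}" and "\<And>x. x \<in> K \<Longrightarrow> \<bar>f x\<bar> \<le> R"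
  shows "osc_on K f \<le> 2 * R"
proof -
  have "(SUP x\<in>K. f x) \<le> R" "- R \<le> (INF x\<in>K. f x)"
    using assms by (auto intro!: cSUP_least cINF_greatest simp: abs_le_iff) force
  then show ?thesis by (simp add: osc_on_def)
qed

lemma osc_on_nonneg:
  assumes "K \<noteq> {}" and "\<And>x. x \<in> K \<Longrightarrow> \<bar>f x\<bar> \<le> R"
  shows "0 \<le> osc_on K f"
proof -
  obtain a where a: "a \<in> K" using assms(1) by blast
  have "bdd_above (f ` K)" "bdd_below (f ` K)"
    using assms(2) by (auto intro!: bdd_aboveI2[of _ _ R] bdd_belowI2[of _ "- R"] simp: abs_le_iff) force
  then have "(INF x\<in>K. f x) \<le> f a" "f a \<le> (SUP x\<in>K. f x)"
    using a by (auto intro: cINF_lower cSUP_upper)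
  then show ?thesis by (simp add: osc_on_def)
qed

theorem theorem2p1:
  shows "\<exists>C::real. C > 0 \<and>
    (\<forall>K :: (real ^ 2) set. compact K \<and> interior K \<noteq> {} \<longrightarrow>
      (\<forall>f :: real ^ 2 \<Rightarrow> real. C2 f \<and> supp f \<subseteq> K \<longrightarrow>
        (osc_on K f)\<^sup>2 \<le>
          (C * (diameter K)\<^sup>2) * (LINT x:K|lborel. \<bar>det (hessian f x)\<bar>)))"
proof (intro exI[of _ "4 / pi"] conjI allI impI)
  fix K :: "(real ^ 2) set" and f :: "real ^ 2 \<Rightarrow> real"
  assume "compact K \<and> interior K \<noteq> {}" and "C2 f \<and> supp f \<subseteq> K"
  then have K: "compact K" and int_K: "interior K \<noteq> {}" and C2: "C2 f" and supp: "supp f \<subseteq> K"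
    by auto
  define d where "d = diameter K"
  define I where "I = (LINT x:K|lborel. \<bar>det (hessian f x)\<bar>)"
  have zero: "f x = 0" if "x \<notin> K" for x
    using that supp closure_subset[of "{x. f x \<noteq> 0}"] by (auto simp: supp_def)
  have d: "d > 0"
  proof -
    obtain x e where e: "e > 0" "ball x e \<subseteq> K" using int_K by (meson all_not_in_conv mem_interior)
    then have "diameter (ball x e) \<le> d"
      unfolding d_def by (intro diameter_subset compact_imp_bounded[OF K])
    then show ?thesis using e(1) by simp
  qed
  have est: "\<bar>f a\<bar> \<le> d * sqrt (I / pi)" for a
  proof -
    have "pi * (\<bar>f a\<bar> / d)\<^sup>2 \<le> I"
      using ABP_estimate[OF K C2 zero, of a] by (simp add: unit_ball_vol_2 I_def d_def)
    then have "\<bar>f a\<bar> / d \<le> sqrt (I / pi)"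
      by (intro real_le_rsqrt) (simp add: field_simps)
    then show ?thesis using d by (simp add: field_simps)
  qed
  have ne: "K \<noteq> {}" using int_K interior_subset by blast
  have "0 \<le> I" unfolding I_def set_lebesgue_integral_def by simp
  have "(osc_on K f)\<^sup>2 \<le> (2 * (d * sqrt (I / pi)))\<^sup>2"
    using est by (intro power_mono osc_on_le osc_on_nonneg ne)
  also have "\<dots> = (4 / pi * d\<^sup>2) * I"
    using \<open>0 \<le> I\<close> by (simp add: power_mult_distrib)
  finally show "(osc_on K f)\<^sup>2 \<le> (4 / pi * (diameter K)\<^sup>2) * (LINT x:K|lborel. \<bar>det (hessian f x)\<bar>)"
    by (simp add: d_def I_def)
qed simp

end
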